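(* For every finitely generated group $G$, the action of $G$ on $L/L'$ (induced by conjugation in $\mathfrak{X}(G)=L\rtimes G$) is nilpotent.
   Context: For a group $G$, let $\overline{G}$ be a second copy of $G$ with a fixed isomorphism $g\mapsto\overline{g}$. The group $\mathfrak{X}(G)$ is the quotient of the free product $G\ast\overline{G}$ by the normal closure of $\{[g,\overline{g}] : g\in G\}$. Let $L=L(G)$ be the kernel of the surjection $\mathfrak{X}(G)\to G$ that sends both $g$ and $\overline{g}$ to $g$; this map splits, giving $\mathfrak{X}(G)=L\rtimes G$. Write $L'=[L,L]$. An action of a group $B$ on an abelian group $A$ is nilpotent if there is an integer $d$ such that $[a,b_1,\dots,b_d]=1$ for all $a\in A$ and $b_1,\dots,b_d\in B$ (left-normed commutators in $A\rtimes B$); equivalently $A\cdot({\rm Aug}(\mathbb{Z}B))^d=0$, where ${\rm Aug}(\mathbb{Z}B)$ is the augmentation ideal. *)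

theory Defs
  imports "HOL-Algebra.Algebra"
begin

definition finitely_generated :: "('a, 'm) monoid_scheme \<Rightarrow> bool" where
  "finitely_generated G \<longleftrightarrow> (\<exists>S. finite S \<and> S \<subseteq> carrier G \<and> generate G S = carrier G)"

definition normal_closure :: "('a, 'm) monoid_scheme \<Rightarrow> 'a set \<Rightarrow> 'a set" where
  "normal_closure G S = \<Inter>{N. N \<lhd> G \<and> S \<subseteq> N}"

definition comm_elt :: "('a, 'm) monoid_scheme \<Rightarrow> 'a \<Rightarrow> 'a \<Rightarrow> 'a" where
  "comm_elt G x y = inv\<^bsub>G\<^esub> x \<otimes>\<^bsub>G\<^esub> inv\<^bsub>G\<^esub> y \<otimes>\<^bsub>G\<^esub> x \<otimes>\<^bsub>G\<^esub> y"

text \<open>The free product \<open>G * H\<close>: words in the disjoint union of the carriers, modulo the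
  congruence of the free monoid generated by the multiplication tables of \<open>G\<close> and \<open>H\<close>.\<close>

definition fp_words :: "('a, 'm) monoid_scheme \<Rightarrow> ('b, 'n) monoid_scheme \<Rightarrow> ('a + 'b) list set" where
  "fp_words G H = lists (carrier G <+> carrier H)"

inductive fp_eq :: "('a, 'm) monoid_scheme \<Rightarrow> ('b, 'n) monoid_scheme
    \<Rightarrow> ('a + 'b) list \<Rightarrow> ('a + 'b) list \<Rightarrow> bool" for G H where
  refl: "u \<in> fp_words G H \<Longrightarrow> fp_eq G H u u"
| sym: "fp_eq G H u v \<Longrightarrow> fp_eq G H v u"
| trans: "fp_eq G H u v \<Longrightarrow> fp_eq G H v w \<Longrightarrow> fp_eq G H u w"
| append: "fp_eq G H u u' \<Longrightarrow> fp_eq G H v v' \<Longrightarrow> fp_eq G H (u @ v) (u' @ v')"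
| one_left: "fp_eq G H [Inl \<one>\<^bsub>G\<^esub>] []"
| one_right: "fp_eq G H [Inr \<one>\<^bsub>H\<^esub>] []"
| mult_left: "x \<in> carrier G \<Longrightarrow> y \<in> carrier G \<Longrightarrow> fp_eq G H [Inl x, Inl y] [Inl (x \<otimes>\<^bsub>G\<^esub> y)]"
| mult_right: "x \<in> carrier H \<Longrightarrow> y \<in> carrier H \<Longrightarrow> fp_eq G H [Inr x, Inr y] [Inr (x \<otimes>\<^bsub>H\<^esub> y)]"

definition fp_rel :: "('a, 'm) monoid_scheme \<Rightarrow> ('b, 'n) monoid_scheme
    \<Rightarrow> (('a + 'b) list \<times> ('a + 'b) list) set" where
  "fp_rel G H = {(u, v). fp_eq G H u v}"

definition free_product :: "('a, 'm) monoid_scheme \<Rightarrow> ('b, 'n) monoid_scheme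
    \<Rightarrow> ('a + 'b) list set monoid" where
  "free_product G H =
    \<lparr>carrier = fp_words G H // fp_rel G H,
     monoid.mult = (\<lambda>A B. \<Union>u\<in>A. \<Union>v\<in>B. fp_rel G H `` {u @ v}),
     one = fp_rel G H `` {[]}\<rparr>"

definition fp_inl :: "('a, 'm) monoid_scheme \<Rightarrow> ('b, 'n) monoid_scheme \<Rightarrow> 'a \<Rightarrow> ('a + 'b) list set" where
  "fp_inl G H x = fp_rel G H `` {[Inl x]}"

definition fp_inr :: "('a, 'm) monoid_scheme \<Rightarrow> ('b, 'n) monoid_scheme \<Rightarrow> 'b \<Rightarrow> ('a + 'b) list set" where
  "fp_inr G H y = fp_rel G H `` {[Inr y]}"

text \<open>The homomorphism \<open>G * H \<rightarrow> K\<close> induced by \<open>f : G \<rightarrow> K\<close> and \<open>h : H \<rightarrow> K\<close>; its value on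
  a class of words is the common value of the words in it.\<close>

definition fp_lift :: "('c, 'k) monoid_scheme \<Rightarrow> ('a \<Rightarrow> 'c) \<Rightarrow> ('b \<Rightarrow> 'c)
    \<Rightarrow> ('a + 'b) list set \<Rightarrow> 'c" where
  "fp_lift K f h A = the_elem ((\<lambda>w. foldr (\<lambda>s z. case_sum f h s \<otimes>\<^bsub>K\<^esub> z) w \<one>\<^bsub>K\<^esub>) ` A)"

text \<open>In \<open>\<XX>(G)\<close> the second copy of \<open>G\<close> is \<open>G\<close> itself in the right summand: the classes of
  \<open>fp_inl G G g\<close> and \<open>fp_inr G G g\<close> are the elements written \<open>g\<close> and \<open>g\<close>-bar.\<close>

definition wc_relators :: "('a, 'm) monoid_scheme \<Rightarrow> ('a + 'a) list set set" where
  "wc_relators G = {comm_elt (free_product G G) (fp_inl G G g) (fp_inr G G g) | g. g \<in> carrier G}"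

definition wc_kernel :: "('a, 'm) monoid_scheme \<Rightarrow> ('a + 'a) list set set" where
  "wc_kernel G = normal_closure (free_product G G) (wc_relators G)"

definition wc_group :: "('a, 'm) monoid_scheme \<Rightarrow> ('a + 'a) list set set monoid" where
  "wc_group G = free_product G G Mod wc_kernel G"

definition wc_proj :: "('a, 'm) monoid_scheme \<Rightarrow> ('a + 'a) list set set \<Rightarrow> 'a" where
  "wc_proj G C = the_elem (fp_lift G (\<lambda>x. x) (\<lambda>x. x) ` C)"

text \<open>The splitting \<open>G \<rightarrow> \<XX>(G)\<close> through the unbarred copy. The barred copy induces the
  same action on \<open>L / L'\<close>, since the two sections differ by elements of \<open>L\<close>.\<close>

definition wc_section :: "('a, 'm) monoid_scheme \<Rightarrow> 'a \<Rightarrow> ('a + 'a) list set set" where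
  "wc_section G g = wc_kernel G #>\<^bsub>free_product G G\<^esub> fp_inl G G g"

definition wc_L :: "('a, 'm) monoid_scheme \<Rightarrow> ('a + 'a) list set set set" where
  "wc_L G = kernel (wc_group G) G (wc_proj G)"

definition wc_L_ab :: "('a, 'm) monoid_scheme \<Rightarrow> ('a + 'a) list set set set monoid" where
  "wc_L_ab G = (wc_group G)\<lparr>carrier := wc_L G\<rparr> Mod derived (wc_group G) (wc_L G)"

text \<open>Conjugation \<open>l L' \<mapsto> g l g\<inverse> L'\<close>, written on cosets as subsets of \<open>\<XX>(G)\<close>.\<close>

definition wc_action :: "('a, 'm) monoid_scheme \<Rightarrow> 'a
    \<Rightarrow> ('a + 'a) list set set set \<Rightarrow> ('a + 'a) list set set set" where
  "wc_action G g = (\<lambda>C \<in> carrier (wc_L_ab G).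
     wc_section G g <#\<^bsub>wc_group G\<^esub> C #>\<^bsub>wc_group G\<^esub> inv\<^bsub>wc_group G\<^esub> (wc_section G g))"

definition semidirect :: "('a, 'm) monoid_scheme \<Rightarrow> ('b, 'n) monoid_scheme
    \<Rightarrow> ('b \<Rightarrow> 'a \<Rightarrow> 'a) \<Rightarrow> ('a \<times> 'b) monoid" where
  "semidirect A B \<phi> =
    \<lparr>carrier = carrier A \<times> carrier B,
     monoid.mult = (\<lambda>(a, b) (a', b'). (a \<otimes>\<^bsub>A\<^esub> \<phi> b a', b \<otimes>\<^bsub>B\<^esub> b')),
     one = (\<one>\<^bsub>A\<^esub>, \<one>\<^bsub>B\<^esub>)\<rparr>"

text \<open>That \<open>\<phi>\<close> is an action of \<open>B\<close> on the abelian group \<open>A\<close> by automorphisms is part of the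
  definition. The \<open>foldl\<close> is the left-normed commutator \<open>[a, b\<^sub>1, \<dots>, b\<^sub>d]\<close> in the semidirect product.\<close>

definition nilpotent_action :: "('b, 'n) monoid_scheme \<Rightarrow> ('a, 'm) monoid_scheme
    \<Rightarrow> ('b \<Rightarrow> 'a \<Rightarrow> 'a) \<Rightarrow> bool" where
  "nilpotent_action B A \<phi> \<longleftrightarrow>
     group B \<and> comm_group A \<and> \<phi> \<in> hom B (AutoGroup A) \<and>
     (\<exists>d. \<forall>a \<in> carrier A. \<forall>bs. set bs \<subseteq> carrier B \<and> length bs = d \<longrightarrow>
        foldl (comm_elt (semidirect A B \<phi>)) (a, \<one>\<^bsub>B\<^esub>) (map (\<lambda>b. (\<one>\<^bsub>A\<^esub>, b)) bs)
          = \<one>\<^bsub>semidirect A B \<phi>\<^esub>)"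

end

theory Submission
  imports Defs
begin

text \<open>\<open>L\<close> is generated by the elements \<open>\<delta> g\<close>, the product of \<open>g\<close>-bar and \<open>g\<inverse>\<close>. In \<open>M = L / L'\<close>, written
  additively, \<open>\<delta> (gh) = \<delta> g + g \<cdot> \<delta> h\<close>, and since \<open>g\<close> commutes with \<open>g\<close>-bar also \<open>g \<cdot> \<delta> g = \<delta> g\<close>; hence
  \<open>(g - 1)\<^sup>2 M = 0\<close> for all \<open>g\<close>. Applying this to \<open>g\<close>, \<open>h\<close> and \<open>gh\<close> shows that the operators \<open>g - 1\<close> and
  \<open>h - 1\<close> anticommute on \<open>M\<close>. So a product of more than \<open>|S|\<close> operators \<open>s - 1\<close> with \<open>s\<close> in a finite
  generating set \<open>S\<close> contains a repetition and vanishes. This carries over to products of the same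
  length of operators \<open>g - 1\<close> with arbitrary \<open>g\<close>, because the elements fixing a given vector form a
  subgroup.\<close>

section \<open>Square-zero actions on abelian groups\<close>

text \<open>Homomorphisms suffice as values of \<open>\<phi>\<close>: by \<open>act_mult\<close> and
  \<open>act_one\<close>, the map \<open>\<phi> (inv g)\<close> is a two-sided inverse of
  \<open>\<phi> g\<close>.\<close>

locale abelian_action = G: group G + A: comm_group A
  for G :: "('g, 'm) monoid_scheme" and A :: "('a, 'n) monoid_scheme" +
  fixes \<phi> :: "'g \<Rightarrow> 'a \<Rightarrow> 'a"
  assumes act_hom: "g \<in> carrier G \<Longrightarrow> \<phi> g \<in> hom A A"
    and act_mult: "\<lbrakk>g \<in> carrier G; h \<in> carrier G; x \<in> carrier A\<rbrakk>
      \<Longrightarrow> \<phi> (g \<otimes>\<^bsub>G\<^esub> h) x = \<phi> g (\<phi> h x)"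
    and act_one: "x \<in> carrier A \<Longrightarrow> \<phi> \<one>\<^bsub>G\<^esub> x = x"
begin

lemma act_closed [simp]: "\<lbrakk>g \<in> carrier G; x \<in> carrier A\<rbrakk> \<Longrightarrow> \<phi> g x \<in> carrier A"
  using act_hom by (auto simp: hom_def)

lemma act_group_hom: "g \<in> carrier G \<Longrightarrow> group_hom A A (\<phi> g)"
  using act_hom by unfold_locales auto

lemma act_add [simp]: "\<lbrakk>g \<in> carrier G; x \<in> carrier A; y \<in> carrier A\<rbrakk>
    \<Longrightarrow> \<phi> g (x \<otimes>\<^bsub>A\<^esub> y) = \<phi> g x \<otimes>\<^bsub>A\<^esub> \<phi> g y"
  using act_hom by (auto simp: hom_def)

lemma act_zero [simp]: "g \<in> carrier G \<Longrightarrow> \<phi> g \<one>\<^bsub>A\<^esub> = \<one>\<^bsub>A\<^esub>"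
  by (rule group_hom.hom_one[OF act_group_hom])

lemma act_minus [simp]: "\<lbrakk>g \<in> carrier G; x \<in> carrier A\<rbrakk> \<Longrightarrow> \<phi> g (inv\<^bsub>A\<^esub> x) = inv\<^bsub>A\<^esub> (\<phi> g x)"
  using group_hom.hom_inv[OF act_group_hom] by auto

lemma act_inv_act [simp]: "\<lbrakk>g \<in> carrier G; x \<in> carrier A\<rbrakk> \<Longrightarrow> \<phi> (inv\<^bsub>G\<^esub> g) (\<phi> g x) = x"
  using act_mult[of "inv\<^bsub>G\<^esub> g" g x] by (simp add: act_one)

lemma act_act_inv [simp]: "\<lbrakk>g \<in> carrier G; x \<in> carrier A\<rbrakk> \<Longrightarrow> \<phi> g (\<phi> (inv\<^bsub>G\<^esub> g) x) = x"
  using act_mult[of g "inv\<^bsub>G\<^esub> g" x] by (simp add: act_one)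

lemma act_eq_one: "\<lbrakk>g \<in> carrier G; x \<in> carrier A; \<phi> g x = \<one>\<^bsub>A\<^esub>\<rbrakk> \<Longrightarrow> x = \<one>\<^bsub>A\<^esub>"
  by (metis G.inv_closed act_inv_act act_zero)

text \<open>The operator \<open>g - 1\<close> of the augmentation ideal, for an abelian group
  written multiplicatively.\<close>

definition diff :: "'g \<Rightarrow> 'a \<Rightarrow> 'a" where
  "diff g x = \<phi> g x \<otimes>\<^bsub>A\<^esub> inv\<^bsub>A\<^esub> x"

lemma diff_closed [simp]: "\<lbrakk>g \<in> carrier G; x \<in> carrier A\<rbrakk> \<Longrightarrow> diff g x \<in> carrier A"
  by (simp add: diff_def)

lemma diff_add [simp]: "\<lbrakk>g \<in> carrier G; x \<in> carrier A; y \<in> carrier A\<rbrakk>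
    \<Longrightarrow> diff g (x \<otimes>\<^bsub>A\<^esub> y) = diff g x \<otimes>\<^bsub>A\<^esub> diff g y"
  by (simp add: diff_def A.inv_mult A.m_ac)

lemma diff_group_hom: "g \<in> carrier G \<Longrightarrow> group_hom A A (diff g)"
  by unfold_locales (auto simp: hom_def)

lemma diff_zero [simp]: "g \<in> carrier G \<Longrightarrow> diff g \<one>\<^bsub>A\<^esub> = \<one>\<^bsub>A\<^esub>"
  by (rule group_hom.hom_one[OF diff_group_hom])

lemma diff_minus [simp]: "\<lbrakk>g \<in> carrier G; x \<in> carrier A\<rbrakk> \<Longrightarrow> diff g (inv\<^bsub>A\<^esub> x) = inv\<^bsub>A\<^esub> (diff g x)"
  using group_hom.hom_inv[OF diff_group_hom] by auto

lemma act_eq_diff: "\<lbrakk>g \<in> carrier G; x \<in> carrier A\<rbrakk> \<Longrightarrow> \<phi> g x = x \<otimes>\<^bsub>A\<^esub> diff g x"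
  by (simp add: diff_def A.m_comm[of x] A.m_assoc)

lemma diff_eq_one_iff: "\<lbrakk>g \<in> carrier G; x \<in> carrier A\<rbrakk> \<Longrightarrow> diff g x = \<one>\<^bsub>A\<^esub> \<longleftrightarrow> \<phi> g x = x"
  by (metis A.inv_equality A.inv_inv A.r_inv A.inv_closed act_closed diff_def)

text \<open>The operator identity \<open>gh - 1 = (g - 1) + (h - 1) + (g - 1)(h - 1)\<close>, from
  which the square of \<open>gh - 1\<close> is expanded later.\<close>

lemma diff_mult:
  assumes "g \<in> carrier G" "h \<in> carrier G" "x \<in> carrier A"
  shows "diff (g \<otimes>\<^bsub>G\<^esub> h) x = diff g x \<otimes>\<^bsub>A\<^esub> diff h x \<otimes>\<^bsub>A\<^esub> diff g (diff h x)"
proof -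
  have "\<phi> (g \<otimes>\<^bsub>G\<^esub> h) x = (diff g x \<otimes>\<^bsub>A\<^esub> diff h x \<otimes>\<^bsub>A\<^esub> diff g (diff h x)) \<otimes>\<^bsub>A\<^esub> x"
    unfolding act_mult[OF assms] using assms by (simp add: act_eq_diff A.m_ac)
  then have "diff (g \<otimes>\<^bsub>G\<^esub> h) x = (diff g x \<otimes>\<^bsub>A\<^esub> diff h x \<otimes>\<^bsub>A\<^esub> diff g (diff h x)) \<otimes>\<^bsub>A\<^esub> x \<otimes>\<^bsub>A\<^esub> inv\<^bsub>A\<^esub> x"
    by (simp only: diff_def[of "g \<otimes>\<^bsub>G\<^esub> h"])
  then show ?thesis
    using assms by (simp add: A.m_assoc)
qed

lemma foldr_diff_closed [simp]:
  "\<lbrakk>set gs \<subseteq> carrier G; x \<in> carrier A\<rbrakk> \<Longrightarrow> foldr diff gs x \<in> carrier A"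
  by (induction gs) auto

lemma foldr_diff_zero [simp]: "set gs \<subseteq> carrier G \<Longrightarrow> foldr diff gs \<one>\<^bsub>A\<^esub> = \<one>\<^bsub>A\<^esub>"
  by (induction gs) auto

lemma subgroup_stabilizer:
  assumes "x \<in> carrier A"
  shows "subgroup {g \<in> carrier G. \<phi> g x = x} G"
proof
  fix g assume "g \<in> {g \<in> carrier G. \<phi> g x = x}"
  then show "inv\<^bsub>G\<^esub> g \<in> {g \<in> carrier G. \<phi> g x = x}"
    using assms by simp (metis act_inv_act)
qed (use assms in \<open>auto simp: act_mult act_one\<close>)

section \<open>Left-normed commutators in the semidirect product\<close>

lemma group_semidirect: "group (semidirect A G \<phi>)"
proof (rule groupI)
  fix z assume "z \<in> carrier (semidirect A G \<phi>)"
  then obtain x g where z: "z = (x, g)" "x \<in> carrier A" "g \<in> carrier G"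
    by (auto simp: semidirect_def)
  \<comment> \<open>In the left inverse of \<open>(x, g)\<close>, the first component has to be
    moved by \<open>inv g\<close> before it is inverted.\<close>
  then show "\<exists>y\<in>carrier (semidirect A G \<phi>). y \<otimes>\<^bsub>semidirect A G \<phi>\<^esub> z = \<one>\<^bsub>semidirect A G \<phi>\<^esub>"
    by (intro bexI[of _ "(inv\<^bsub>A\<^esub> (\<phi> (inv\<^bsub>G\<^esub> g) x), inv\<^bsub>G\<^esub> g)"]) (auto simp: semidirect_def)
qed (auto simp: semidirect_def act_one act_mult A.m_assoc G.m_assoc)

text \<open>With the convention \<open>[x, y] = x\<inverse> y\<inverse> x y\<close>, the conjugation
  of \<open>x\<close> is by \<open>inv g\<close>, so the commutator yields the operator of
  \<open>inv g\<close> instead of \<open>g\<close>.\<close>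

lemma comm_elt_semidirect:
  assumes "x \<in> carrier A" "g \<in> carrier G"
  shows "comm_elt (semidirect A G \<phi>) (x, \<one>\<^bsub>G\<^esub>) (\<one>\<^bsub>A\<^esub>, g) = (diff (inv\<^bsub>G\<^esub> g) x, \<one>\<^bsub>G\<^esub>)"
proof -
  let ?S = "semidirect A G \<phi>"
  have "inv\<^bsub>?S\<^esub> (x, \<one>\<^bsub>G\<^esub>) = (inv\<^bsub>A\<^esub> x, \<one>\<^bsub>G\<^esub>)" "inv\<^bsub>?S\<^esub> (\<one>\<^bsub>A\<^esub>, g) = (\<one>\<^bsub>A\<^esub>, inv\<^bsub>G\<^esub> g)"
    by (rule group.inv_equality[OF group_semidirect]; use assms in \<open>simp add: semidirect_def act_one\<close>)+
  then show ?thesis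
    using assms by (simp add: comm_elt_def) (simp add: semidirect_def act_one diff_def A.m_comm)
qed

text \<open>The first entry of a left-normed commutator acts first and is therefore innermost;
  \<open>foldr\<close> applies its last entry first, hence the reversal.\<close>

lemma foldl_comm_elt_semidirect:
  assumes "x \<in> carrier A" "set gs \<subseteq> carrier G"
  shows "foldl (comm_elt (semidirect A G \<phi>)) (x, \<one>\<^bsub>G\<^esub>) (map (\<lambda>g. (\<one>\<^bsub>A\<^esub>, g)) gs)
    = (foldr diff (rev (map (m_inv G) gs)) x, \<one>\<^bsub>G\<^esub>)"
  using assms by (induction gs arbitrary: x) (auto simp: comm_elt_semidirect)

end

section \<open>Actions with \<open>(g - 1)\<^sup>2 = 0\<close>\<close>

locale square_zero_action = abelian_action G A \<phi>
  for G :: "('g, 'm) monoid_scheme" and A :: "('a, 'n) monoid_scheme" and \<phi> +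
  assumes diff_diff: "\<lbrakk>g \<in> carrier G; x \<in> carrier A\<rbrakk> \<Longrightarrow> diff g (diff g x) = \<one>\<^bsub>A\<^esub>"
begin

text \<open>Expanding \<open>diff (g h)\<^sup>2 = 0\<close> with \<open>a = diff g\<close>, \<open>b = diff h\<close> gives \<open>ab + ba + aba + bab + abab = 0\<close>.
  Multiplying by \<open>b\<close> on the right leaves \<open>(1 + a)bab = 0\<close>, and \<open>1 + a\<close> is invertible.\<close>

lemma diff_expand:
  assumes "g \<in> carrier G" "h \<in> carrier G" "x \<in> carrier A"
  shows "diff g (diff h x) \<otimes>\<^bsub>A\<^esub> (diff h (diff g x) \<otimes>\<^bsub>A\<^esub> (diff g (diff h (diff g x))
    \<otimes>\<^bsub>A\<^esub> (diff h (diff g (diff h x)) \<otimes>\<^bsub>A\<^esub> diff g (diff h (diff g (diff h x)))))) = \<one>\<^bsub>A\<^esub>"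
  using diff_diff[of "g \<otimes>\<^bsub>G\<^esub> h" x] assms by (simp add: diff_mult diff_diff A.m_ac)

lemma diff_sandwich:
  assumes "g \<in> carrier G" "h \<in> carrier G" "x \<in> carrier A"
  shows "diff h (diff g (diff h x)) = \<one>\<^bsub>A\<^esub>"
proof (rule act_eq_one[OF assms(1)])
  show "\<phi> g (diff h (diff g (diff h x))) = \<one>\<^bsub>A\<^esub>"
    using diff_expand[of g h "diff h x"] assms by (simp add: diff_diff act_eq_diff)
qed (use assms in simp)

text \<open>By \<open>diff_sandwich\<close>, for the pair in either order, all terms of degree three
  and four in \<open>diff_expand\<close> vanish, which leaves \<open>ab + ba = 0\<close>.\<close>

lemma diff_anticommute:
  assumes "g \<in> carrier G" "h \<in> carrier G" "x \<in> carrier A"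
  shows "diff g (diff h x) = inv\<^bsub>A\<^esub> (diff h (diff g x))"
  using diff_expand[OF assms] assms by (intro A.inv_equality[symmetric]) (simp_all add: diff_sandwich)

text \<open>Anticommutation moves \<open>diff g\<close> through the whole list up to sign, and a
  sign does not affect vanishing.\<close>

lemma diff_foldr_diff:
  assumes "g \<in> carrier G" "set hs \<subseteq> carrier G" "x \<in> carrier A"
  shows "diff g (foldr diff hs x) = \<one>\<^bsub>A\<^esub> \<longleftrightarrow> foldr diff hs (diff g x) = \<one>\<^bsub>A\<^esub>"
proof -
  \<comment> \<open>Allowing both signs avoids tracking the parity of the length of
    \<open>hs\<close>.\<close>
  have "diff g (foldr diff hs x) \<in> {foldr diff hs (diff g x), inv\<^bsub>A\<^esub> (foldr diff hs (diff g x))}"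
    using assms(2)
  proof (induction hs)
    case (Cons h hs)
    then show ?case
      using assms by (auto simp: diff_anticommute[of g h])
  qed simp
  then show ?thesis
    using assms by (metis A.inv_eq_1_iff diff_closed foldr_diff_closed insertE singletonD)
qed

text \<open>The two equal operators are brought together by \<open>diff_foldr_diff\<close>, where
  their product is zero.\<close>

lemma foldr_diff_repeated:
  assumes "set gs \<subseteq> carrier G" "\<not> distinct gs" "x \<in> carrier A"
  shows "foldr diff gs x = \<one>\<^bsub>A\<^esub>"
proof -
  obtain us g vs ws where gs: "gs = us @ [g] @ vs @ [g] @ ws"
    using not_distinct_decomp[OF assms(2)] by blast
  then have "diff g (foldr diff vs (diff g (foldr diff ws x))) = \<one>\<^bsub>A\<^esub>"
    using assms by (auto simp: diff_foldr_diff diff_diff)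
  then show ?thesis
    using assms gs by simp
qed

text \<open>Induction on the length with the vector arbitrary: the induction hypothesis at
  \<open>diff s x\<close> frees the inner entries, and a stabilizer argument then frees the
  outermost one.\<close>

lemma foldr_diff_eq_one_of_generators:
  assumes "S \<subseteq> carrier G" "generate G S = carrier G"
    and "x \<in> carrier A"
    and "\<And>ss. \<lbrakk>set ss \<subseteq> S; length ss = d\<rbrakk> \<Longrightarrow> foldr diff ss x = \<one>\<^bsub>A\<^esub>"
    and "set gs \<subseteq> carrier G" "length gs = d"
  shows "foldr diff gs x = \<one>\<^bsub>A\<^esub>"
  using assms(3-)
proof (induction d arbitrary: x gs)
  case (Suc d)
  from Suc.prems(3,4) obtain g hs
    where gs: "gs = g # hs" "length hs = d" "g \<in> carrier G" "set hs \<subseteq> carrier G"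
    by (cases gs) auto
  let ?y = "foldr diff hs x"
  have y: "?y \<in> carrier A"
    using Suc.prems(1) gs by simp
  \<comment> \<open>It is enough that every generator fixes \<open>?y\<close>, since the stabilizer
    of \<open>?y\<close> is then all of \<open>G\<close>.\<close>
  have "S \<subseteq> {g \<in> carrier G. \<phi> g ?y = ?y}"
  proof
    fix s assume s: "s \<in> S"
    have "foldr diff hs (diff s x) = \<one>\<^bsub>A\<^esub>"
    proof (rule Suc.IH)
      fix ss assume "set ss \<subseteq> S" "length ss = d"
      \<comment> \<open>Appending \<open>s\<close> at the end makes it the innermost operator, so
        the hypothesis for length \<open>Suc d\<close> applies.\<close>
      then show "foldr diff ss (diff s x) = \<one>\<^bsub>A\<^esub>"
        using Suc.prems(2)[of "ss @ [s]"] s by simp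
    qed (use s assms(1) Suc.prems(1) gs in auto)
    then show "s \<in> {g \<in> carrier G. \<phi> g ?y = ?y}"
      using s assms(1) Suc.prems(1) gs y by (auto simp: diff_foldr_diff diff_eq_one_iff[symmetric])
  qed
  then have "\<phi> g ?y = ?y"
    using G.generate_subgroup_incl[OF _ subgroup_stabilizer[OF y]] assms(2) gs by blast
  then show ?case
    using gs y by (simp add: diff_eq_one_iff)
qed auto

text \<open>Pigeonhole: \<open>Suc (card S)\<close> entries from \<open>S\<close> cannot be
  distinct.\<close>

theorem foldr_diff_nilpotent:
  assumes "finite S" "S \<subseteq> carrier G" "generate G S = carrier G"
    and "x \<in> carrier A" "set gs \<subseteq> carrier G" "length gs = Suc (card S)"
  shows "foldr diff gs x = \<one>\<^bsub>A\<^esub>"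
proof (rule foldr_diff_eq_one_of_generators[OF assms(2-4) _ assms(5,6)])
  fix ss assume ss: "set ss \<subseteq> S" "length ss = Suc (card S)"
  then have "\<not> distinct ss"
    using distinct_card[of ss] card_mono[OF assms(1) ss(1)] by auto
  then show "foldr diff ss x = \<one>\<^bsub>A\<^esub>"
    using ss assms foldr_diff_repeated by blast
qed

end

section \<open>Modules generated by a crossed homomorphism\<close>

locale crossed_hom_action = abelian_action G A \<phi>
  for G :: "('g, 'm) monoid_scheme" and A :: "('a, 'n) monoid_scheme" and \<phi> +
  fixes m :: "'g \<Rightarrow> 'a"
  assumes m_closed [simp]: "g \<in> carrier G \<Longrightarrow> m g \<in> carrier A"
    and m_mult: "\<lbrakk>g \<in> carrier G; h \<in> carrier G\<rbrakk> \<Longrightarrow> m (g \<otimes>\<^bsub>G\<^esub> h) = m g \<otimes>\<^bsub>A\<^esub> \<phi> g (m h)"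
    and m_fixed: "g \<in> carrier G \<Longrightarrow> \<phi> g (m g) = m g"
    and generate_m: "generate A (m ` carrier G) = carrier A"
begin

text \<open>The cocycle identity solved for the translate, modelled on
  \<open>g(h - 1) = (gh - 1) - (g - 1)\<close>.\<close>

lemma act_m: "\<lbrakk>g \<in> carrier G; h \<in> carrier G\<rbrakk> \<Longrightarrow> \<phi> g (m h) = m (g \<otimes>\<^bsub>G\<^esub> h) \<otimes>\<^bsub>A\<^esub> inv\<^bsub>A\<^esub> m g"
  by (simp add: m_mult A.m_comm[of "m g"] A.m_assoc)

text \<open>\<open>m g\<close> plays the role of \<open>g - 1\<close> in the augmentation ideal modulo all \<open>(g - 1)\<^sup>2\<close>. Since
  \<open>(g - 1)\<^sup>2h = h(k - 1)\<^sup>2\<close> for \<open>k = h\<inverse>gh\<close>, the ideal generated by these squares is two-sided, so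
  \<open>(g - 1)\<^sup>2\<close> annihilates the module and not just \<open>m g\<close>.\<close>

lemma diff_diff_m:
  assumes g: "g \<in> carrier G" and h: "h \<in> carrier G"
  shows "diff g (diff g (m h)) = \<one>\<^bsub>A\<^esub>"
proof -
  define k where "k = inv\<^bsub>G\<^esub> h \<otimes>\<^bsub>G\<^esub> g \<otimes>\<^bsub>G\<^esub> h"
  have k: "k \<in> carrier G" and hk: "h \<otimes>\<^bsub>G\<^esub> k = g \<otimes>\<^bsub>G\<^esub> h"
    using g h by (simp_all add: k_def G.m_assoc[symmetric])
  have gh: "\<phi> h (m k) = m (g \<otimes>\<^bsub>G\<^esub> h) \<otimes>\<^bsub>A\<^esub> inv\<^bsub>A\<^esub> m h"
    using act_m[OF h k] hk by simp
  have "\<phi> g (\<phi> h (m k)) = \<phi> h (\<phi> k (m k))"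
    using act_mult g h k hk by (metis m_closed)
  then have "\<phi> g (m (g \<otimes>\<^bsub>G\<^esub> h) \<otimes>\<^bsub>A\<^esub> inv\<^bsub>A\<^esub> m h) = m (g \<otimes>\<^bsub>G\<^esub> h) \<otimes>\<^bsub>A\<^esub> inv\<^bsub>A\<^esub> m h"
    using gh by (simp add: m_fixed k)
  \<comment> \<open>The vector just shown to be fixed by \<open>g\<close> differs from
    \<open>diff g (m h)\<close> by \<open>m g\<close>, which \<open>g\<close> fixes by
    \<open>m_fixed\<close>.\<close>
  moreover have "diff g (m h) = (m (g \<otimes>\<^bsub>G\<^esub> h) \<otimes>\<^bsub>A\<^esub> inv\<^bsub>A\<^esub> m h) \<otimes>\<^bsub>A\<^esub> inv\<^bsub>A\<^esub> m g"
    using g h by (simp add: diff_def act_m A.m_ac)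
  ultimately have "\<phi> g (diff g (m h)) = diff g (m h)"
    using g h act_add[of g "m (g \<otimes>\<^bsub>G\<^esub> h) \<otimes>\<^bsub>A\<^esub> inv\<^bsub>A\<^esub> m h" "inv\<^bsub>A\<^esub> m g"] by (simp add: m_fixed del: act_add)
  then show ?thesis
    using g h by (simp add: diff_eq_one_iff)
qed

text \<open>The square of \<open>diff g\<close> is an endomorphism of \<open>A\<close>, so it
  vanishes once it vanishes on the generators \<open>m h\<close>.\<close>

sublocale square_zero_action
proof
  fix g x assume g: "g \<in> carrier G" and "x \<in> carrier A"
  then have "x \<in> generate A (m ` carrier G)"
    by (simp add: generate_m)
  then show "diff g (diff g x) = \<one>\<^bsub>A\<^esub>"
  proof (induction rule: generate.induct)
    case (eng x y)
    then have "x \<in> carrier A" "y \<in> carrier A"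
      by (simp_all add: generate_m)
    with eng g show ?case by simp
  qed (use g in \<open>auto simp: diff_diff_m\<close>)
qed

text \<open>Elements of \<open>AutoGroup A\<close> are extensional maps compared as total functions;
  this is the purpose of \<open>ext\<close>.\<close>

theorem nilpotent_action:
  assumes "finitely_generated G" and ext: "\<And>g. g \<in> carrier G \<Longrightarrow> \<phi> g \<in> extensional (carrier A)"
  shows "nilpotent_action G A \<phi>"
  unfolding nilpotent_action_def
proof (intro conjI)
  obtain S where S: "finite S" "S \<subseteq> carrier G" "generate G S = carrier G"
    using assms(1) by (auto simp: finitely_generated_def)
  have bij: "bij_betw (\<phi> g) (carrier A) (carrier A)" if "g \<in> carrier G" for g
    using that by (intro bij_betw_byWitness[of _ "\<phi> (inv\<^bsub>G\<^esub> g)"]) auto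
  show "\<phi> \<in> hom G (AutoGroup A)"
  proof (rule homI)
    show "\<phi> g \<in> carrier (AutoGroup A)" if "g \<in> carrier G" for g
      using that ext bij act_hom by (simp add: AutoGroup_def auto_def Bij_def)
    show "\<phi> (g \<otimes>\<^bsub>G\<^esub> h) = \<phi> g \<otimes>\<^bsub>AutoGroup A\<^esub> \<phi> h" if "g \<in> carrier G" "h \<in> carrier G" for g h
      using that ext[OF that(1)] ext[OF that(2)] ext[of "g \<otimes>\<^bsub>G\<^esub> h"] bij
      by (auto simp: AutoGroup_def BijGroup_def Bij_def compose_def act_mult intro!: extensionalityI)
  qed
  show "\<exists>d. \<forall>x\<in>carrier A. \<forall>gs. set gs \<subseteq> carrier G \<and> length gs = d \<longrightarrow>
      foldl (comm_elt (semidirect A G \<phi>)) (x, \<one>\<^bsub>G\<^esub>) (map (\<lambda>g. (\<one>\<^bsub>A\<^esub>, g)) gs) = \<one>\<^bsub>semidirect A G \<phi>\<^esub>"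
  proof (intro exI[of _ "Suc (card S)"] ballI allI impI)
    fix x gs assume "x \<in> carrier A" and gs: "set gs \<subseteq> carrier G \<and> length gs = Suc (card S)"
    \<comment> \<open>The commutators produce operators of inverses in reversed order; the vanishing
      holds for arbitrary entries and covers this list as well.\<close>
    moreover have "set (rev (map (m_inv G) gs)) \<subseteq> carrier G"
      using gs by auto
    ultimately have "foldr diff (rev (map (m_inv G) gs)) x = \<one>\<^bsub>A\<^esub>"
      using S by (intro foldr_diff_nilpotent[OF S]) auto
    then show "foldl (comm_elt (semidirect A G \<phi>)) (x, \<one>\<^bsub>G\<^esub>) (map (\<lambda>g. (\<one>\<^bsub>A\<^esub>, g)) gs)
        = \<one>\<^bsub>semidirect A G \<phi>\<^esub>"
      using \<open>x \<in> carrier A\<close> gs by (simp only: foldl_comm_elt_semidirect) (simp add: semidirect_def)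
  qed
qed (fact G.group_axioms A.comm_group_axioms)+

end

section \<open>Groups generated by two commuting sections\<close>

text \<open>The structure of \<XX>(G) on which the argument rests: \<open>s\<close> and
  \<open>t\<close> stand for the two copies of \<open>G\<close>, and \<open>p\<close> for the
  projection that both of them split.\<close>

locale commuting_sections = Y: group Y + G: group G
  for Y :: "('y, 'n) monoid_scheme" (structure) and G :: "('g, 'm) monoid_scheme" +
  fixes s t :: "'g \<Rightarrow> 'y" and p :: "'y \<Rightarrow> 'g"
  assumes s_hom: "s \<in> hom G Y" and t_hom: "t \<in> hom G Y" and p_hom: "p \<in> hom Y G"
    and p_s: "g \<in> carrier G \<Longrightarrow> p (s g) = g" and p_t: "g \<in> carrier G \<Longrightarrow> p (t g) = g"
    and s_t_commute: "g \<in> carrier G \<Longrightarrow> s g \<otimes> t g = t g \<otimes> s g"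
    and generate_s_t: "generate Y (s ` carrier G \<union> t ` carrier G) = carrier Y"
begin

sublocale s: group_hom G Y s
  using s_hom by unfold_locales
sublocale t: group_hom G Y t
  using t_hom by unfold_locales
sublocale p: group_hom Y G p
  using p_hom by unfold_locales

definition L :: "'y set" where
  "L = kernel Y G p"

definition \<delta> :: "'g \<Rightarrow> 'y" where
  "\<delta> g = t g \<otimes> inv s g"

lemma \<delta>_closed [simp]: "g \<in> carrier G \<Longrightarrow> \<delta> g \<in> carrier Y"
  by (simp add: \<delta>_def)

lemma normal_L: "L \<lhd> Y"
  unfolding L_def by (rule p.normal_kernel)

lemma subgroup_L: "subgroup L Y"
  using normal_L by (rule normal_imp_subgroup)

lemma \<delta>_in_L: "g \<in> carrier G \<Longrightarrow> \<delta> g \<in> L"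
  by (simp add: L_def kernel_def \<delta>_def p_s p_t)

text \<open>Inserting \<open>inv s g \<otimes> s g\<close> between \<open>t g\<close> and
  \<open>t h\<close> gives the crossed homomorphism law, already in \<open>Y\<close> and before
  passing to \<open>L / L'\<close>.\<close>

lemma \<delta>_mult:
  assumes "g \<in> carrier G" "h \<in> carrier G"
  shows "\<delta> (g \<otimes>\<^bsub>G\<^esub> h) = \<delta> g \<otimes> (s g \<otimes> \<delta> h \<otimes> inv s g)"
proof -
  have "\<delta> g \<otimes> (s g \<otimes> \<delta> h \<otimes> inv s g) = t g \<otimes> (inv s g \<otimes> s g) \<otimes> t h \<otimes> (inv s h \<otimes> inv s g)"
    using assms by (simp add: \<delta>_def Y.m_assoc Y.inv_solve_left')
  then show ?thesis
    using assms by (simp add: \<delta>_def Y.inv_mult_group)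
qed

text \<open>Here the relations \<open>[g, g-bar] = 1\<close> enter, through
  \<open>s_t_commute\<close>.\<close>

lemma \<delta>_fixed: "g \<in> carrier G \<Longrightarrow> s g \<otimes> \<delta> g \<otimes> inv s g = \<delta> g"
  by (simp add: \<delta>_def Y.m_assoc[symmetric] s_t_commute) (simp add: Y.m_assoc)

text \<open>Solving \<open>\<delta>_mult\<close> for the conjugate of \<open>\<delta> h\<close>
  expresses it as \<open>inv \<delta> g \<otimes> \<delta> (gh)\<close>, so \<open>s\<close>
  normalizes the subgroup generated by the \<open>\<delta> g\<close>.\<close>

lemma conj_generate_\<delta>:
  assumes g: "g \<in> carrier G" and x: "x \<in> generate Y (\<delta> ` carrier G)"
  shows "s g \<otimes> x \<otimes> inv s g \<in> generate Y (\<delta> ` carrier G)" (is "_ \<in> ?W")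
proof -
  have W: "subgroup ?W Y"
    by (intro Y.generate_is_subgroup) auto
  have \<delta>: "s g \<otimes> \<delta> h \<otimes> inv s g \<in> ?W" if h: "h \<in> carrier G" for h
  proof -
    have "s g \<otimes> \<delta> h \<otimes> inv s g = inv \<delta> g \<otimes> \<delta> (g \<otimes>\<^bsub>G\<^esub> h)"
      using g h by (simp add: \<delta>_mult Y.m_assoc[symmetric])
    then show ?thesis
      using g h by (auto intro: subgroup.m_closed[OF W] subgroup.m_inv_closed[OF W] generate.incl)
  qed
  show ?thesis
    using x
  proof (induction rule: generate.induct)
    case one
    then show ?case using g by (simp add: generate.one)
  next
    case (incl x)
    then show ?case using \<delta> by auto
  next
    case (inv x)
    then obtain h where h: "h \<in> carrier G" "x = \<delta> h"
      by auto
    then have "s g \<otimes> inv x \<otimes> inv s g = inv (s g \<otimes> \<delta> h \<otimes> inv s g)"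
      using g by (simp add: Y.inv_mult_group Y.m_assoc)
    then show ?case
      using \<delta>[OF h(1)] subgroup.m_inv_closed[OF W] by simp
  next
    case (eng x y)
    then have "x \<in> carrier Y" "y \<in> carrier Y"
      using subgroup.subset[OF W] by auto
    then have "s g \<otimes> (x \<otimes> y) \<otimes> inv s g = (s g \<otimes> x \<otimes> inv s g) \<otimes> (s g \<otimes> y \<otimes> inv s g)"
      using g by (simp add: Y.m_assoc[symmetric] Y.inv_solve_right') (simp add: Y.m_assoc)
    then show ?case
      using eng subgroup.m_closed[OF W] by simp
  qed
qed

text \<open>The products \<open>l \<otimes> s g\<close> include both copies of \<open>G\<close>,
  because \<open>t g = \<delta> g \<otimes> s g\<close>, and they are closed under multiplication by
  \<open>conj_generate_\<delta>\<close>.\<close>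

lemma decompose:
  assumes "x \<in> carrier Y"
  obtains l g where "l \<in> generate Y (\<delta> ` carrier G)" "g \<in> carrier G" "x = l \<otimes> s g"
proof -
  let ?W = "generate Y (\<delta> ` carrier G)"
  have W: "subgroup ?W Y"
    by (intro Y.generate_is_subgroup) auto
  have s: "\<exists>l\<in>?W. \<exists>h\<in>carrier G. s g = l \<otimes> s h" if "g \<in> carrier G" for g
    using that by (intro bexI[of _ \<one>] bexI[of _ g]) (auto intro: generate.one)
  have t: "\<exists>l\<in>?W. \<exists>h\<in>carrier G. t g = l \<otimes> s h" if "g \<in> carrier G" for g
    using that by (intro bexI[of _ "\<delta> g"] bexI[of _ g]) (auto intro: generate.incl simp: \<delta>_def Y.m_assoc)
  have "x \<in> generate Y (s ` carrier G \<union> t ` carrier G)"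
    using assms by (simp add: generate_s_t)
  then have "\<exists>l\<in>?W. \<exists>h\<in>carrier G. x = l \<otimes> s h"
  proof (induction rule: generate.induct)
    case one
    show ?case using s[of "\<one>\<^bsub>G\<^esub>"] by simp
  next
    case (incl x)
    then show ?case using s t by auto
  next
    case (inv x)
    then obtain g where "g \<in> carrier G" "inv x = s (inv\<^bsub>G\<^esub> g) \<or> inv x = t (inv\<^bsub>G\<^esub> g)"
      by auto
    then show ?case using s t by (metis G.inv_closed)
  next
    case (eng x y)
    then obtain k g l h where *: "k \<in> ?W" "g \<in> carrier G" "x = k \<otimes> s g"
      "l \<in> ?W" "h \<in> carrier G" "y = l \<otimes> s h"
      by blast
    then have "k \<in> carrier Y" "l \<in> carrier Y"
      using subgroup.subset[OF W] by auto
    with * have "x \<otimes> y = (k \<otimes> (s g \<otimes> l \<otimes> inv s g)) \<otimes> s (g \<otimes>\<^bsub>G\<^esub> h)"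
      by (simp add: Y.m_assoc) (simp add: Y.m_assoc[symmetric])
    moreover have "k \<otimes> (s g \<otimes> l \<otimes> inv s g) \<in> ?W"
      using * conj_generate_\<delta> subgroup.m_closed[OF W] by blast
    ultimately show ?case
      using * by blast
  qed
  then show thesis using that by blast
qed

text \<open>If \<open>l \<otimes> s g\<close> lies in the kernel of \<open>p\<close>, then
  \<open>g\<close> is trivial, since \<open>p\<close> kills \<open>l\<close> and sends
  \<open>s g\<close> to \<open>g\<close>.\<close>

lemma generate_\<delta>: "generate Y (\<delta> ` carrier G) = L"
proof
  show W: "generate Y (\<delta> ` carrier G) \<subseteq> L"
    using \<delta>_in_L by (intro Y.generate_subgroup_incl[OF _ subgroup_L]) auto
  show "L \<subseteq> generate Y (\<delta> ` carrier G)"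
  proof
    fix x assume x: "x \<in> L"
    then have "x \<in> carrier Y"
      by (simp add: L_def kernel_def)
    then obtain l g where l: "l \<in> generate Y (\<delta> ` carrier G)" and g: "g \<in> carrier G" "x = l \<otimes> s g"
      by (rule decompose)
    then have "l \<in> carrier Y" "p l = \<one>\<^bsub>G\<^esub>"
      using W by (auto simp: L_def kernel_def)
    then have "g = \<one>\<^bsub>G\<^esub>"
      using x g by (simp add: L_def kernel_def p_s)
    then show "x \<in> generate Y (\<delta> ` carrier G)"
      using l g \<open>l \<in> carrier Y\<close> by simp
  qed
qed

section \<open>The abelian group \<open>L / L'\<close> with the conjugation action\<close>

abbreviation L' :: "'y set" where
  "L' \<equiv> derived Y L"

definition L_ab :: "'y set monoid" where
  "L_ab = Y\<lparr>carrier := L\<rparr> Mod L'"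

definition conj_action :: "'g \<Rightarrow> 'y set \<Rightarrow> 'y set" where
  "conj_action g = (\<lambda>C \<in> carrier L_ab. s g <# C #> inv s g)"

lemma normal_L': "L' \<lhd> Y"
  by (rule Y.derived_is_normal[OF normal_L])

lemma comm_group_L_ab: "comm_group L_ab"
  unfolding L_ab_def by (rule Y.derived_quot_of_subgroup_is_comm_group[OF subgroup_L])

lemma carrier_L_ab: "carrier L_ab = (\<lambda>x. L' #> x) ` L"
  by (simp add: L_ab_def carrier_FactGroup)

lemma coset_hom: "(\<lambda>x. L' #> x) \<in> hom (Y\<lparr>carrier := L\<rparr>) L_ab"
proof (rule homI)
  fix x y assume "x \<in> carrier (Y\<lparr>carrier := L\<rparr>)" "y \<in> carrier (Y\<lparr>carrier := L\<rparr>)"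
  then show "L' #> (x \<otimes>\<^bsub>Y\<lparr>carrier := L\<rparr>\<^esub> y) = (L' #> x) \<otimes>\<^bsub>L_ab\<^esub> (L' #> y)"
    using subgroup.mem_carrier[OF subgroup_L] normal.rcos_sum[OF normal_L'] by (simp add: L_ab_def)
qed (simp add: carrier_L_ab)

lemma coset_mult: "\<lbrakk>x \<in> L; y \<in> L\<rbrakk> \<Longrightarrow> (L' #> x) \<otimes>\<^bsub>L_ab\<^esub> (L' #> y) = L' #> (x \<otimes> y)"
  using hom_mult[OF coset_hom, of x y] by simp

lemma conj_in_L: "\<lbrakk>g \<in> carrier G; x \<in> L\<rbrakk> \<Longrightarrow> s g \<otimes> x \<otimes> inv s g \<in> L"
  using normal.inv_op_closed2[OF normal_L] by simp

text \<open>Normality of \<open>L'\<close> in all of \<open>Y\<close> lets \<open>s g\<close> pass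
  from the left of the coset to the right of \<open>L'\<close>.\<close>

lemma conj_action_coset:
  assumes g: "g \<in> carrier G" and x: "x \<in> L"
  shows "conj_action g (L' #> x) = L' #> (s g \<otimes> x \<otimes> inv s g)"
proof -
  interpret L': normal L' Y by (rule normal_L')
  have x': "x \<in> carrier Y"
    using x subgroup.mem_carrier[OF subgroup_L] by simp
  have "s g <# (L' #> x) #> inv s g = L' #> s g #> x #> inv s g"
    using g x' L'.subset L'.coset_eq[rule_format, of "s g"] by (simp only: Y.coset_assoc s.hom_closed)
  then show ?thesis
    using g x x' L'.subset by (simp add: conj_action_def carrier_L_ab Y.coset_mult_assoc Y.m_assoc)
qed

text \<open>The crossed homomorphism law, the fixed vectors and generation come from
  \<open>\<delta>_mult\<close>, \<open>\<delta>_fixed\<close> and \<open>generate_\<delta>\<close>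
  respectively, pushed through the quotient map.\<close>

sublocale crossed_hom_action G L_ab conj_action "\<lambda>g. L' #> \<delta> g"
proof (intro crossed_hom_action.intro abelian_action.intro abelian_action_axioms.intro
    crossed_hom_action_axioms.intro)
  show "comm_group L_ab" by (rule comm_group_L_ab)
  show "Group.group G" by (rule G.group_axioms)
  fix g assume g: "g \<in> carrier G"
  show "L' #> \<delta> g \<in> carrier L_ab"
    using g \<delta>_in_L by (auto simp: carrier_L_ab)
  show "conj_action g (L' #> \<delta> g) = L' #> \<delta> g"
    using g by (simp add: conj_action_coset \<delta>_in_L \<delta>_fixed)
  show "conj_action g \<in> hom L_ab L_ab"
  proof (rule homI)
    fix a b assume "a \<in> carrier L_ab" "b \<in> carrier L_ab"
    then obtain x y where *: "a = L' #> x" "b = L' #> y" "x \<in> L" "y \<in> L"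
      by (auto simp: carrier_L_ab)
    show "conj_action g a \<in> carrier L_ab"
      using * g by (auto simp: conj_action_coset carrier_L_ab conj_in_L)
    have "x \<in> carrier Y" "y \<in> carrier Y" "x \<otimes> y \<in> L"
      using * subgroup.mem_carrier[OF subgroup_L] subgroup.m_closed[OF subgroup_L] by auto
    moreover from this have "s g \<otimes> (x \<otimes> y) \<otimes> inv s g = (s g \<otimes> x \<otimes> inv s g) \<otimes> (s g \<otimes> y \<otimes> inv s g)"
      using g by (simp add: Y.m_assoc[symmetric] Y.inv_solve_right') (simp add: Y.m_assoc)
    ultimately show "conj_action g (a \<otimes>\<^bsub>L_ab\<^esub> b) = conj_action g a \<otimes>\<^bsub>L_ab\<^esub> conj_action g b"
      using * g by (simp add: coset_mult conj_action_coset conj_in_L)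
  qed
  fix h assume h: "h \<in> carrier G"
  show "L' #> \<delta> (g \<otimes>\<^bsub>G\<^esub> h) = (L' #> \<delta> g) \<otimes>\<^bsub>L_ab\<^esub> conj_action g (L' #> \<delta> h)"
    using g h by (simp add: \<delta>_mult conj_action_coset \<delta>_in_L coset_mult conj_in_L)
  fix a assume "a \<in> carrier L_ab"
  then obtain x where *: "a = L' #> x" "x \<in> L"
    by (auto simp: carrier_L_ab)
  then have "x \<in> carrier Y"
    using subgroup.mem_carrier[OF subgroup_L] by auto
  then have "s (g \<otimes>\<^bsub>G\<^esub> h) \<otimes> x \<otimes> inv s (g \<otimes>\<^bsub>G\<^esub> h) = s g \<otimes> (s h \<otimes> x \<otimes> inv s h) \<otimes> inv s g"
    using g h by (simp add: Y.inv_mult_group Y.m_assoc)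
  then show "conj_action (g \<otimes>\<^bsub>G\<^esub> h) a = conj_action g (conj_action h a)"
    using * g h by (simp add: conj_action_coset conj_in_L del: s.hom_mult)
next
  fix a assume "a \<in> carrier L_ab"
  then obtain x where *: "a = L' #> x" "x \<in> L"
    by (auto simp: carrier_L_ab)
  then have "x \<in> carrier Y"
    using subgroup.mem_carrier[OF subgroup_L] by auto
  then show "conj_action \<one>\<^bsub>G\<^esub> a = a"
    using * by (simp add: conj_action_coset)
next
  interpret \<pi>: group_hom "Y\<lparr>carrier := L\<rparr>" L_ab "\<lambda>x. L' #> x"
    using coset_hom comm_group_L_ab Y.subgroup_imp_group[OF subgroup_L]
    by (simp add: group_hom_def group_hom_axioms_def comm_group_def)
  have "generate L_ab ((\<lambda>x. L' #> x) ` \<delta> ` carrier G) = (\<lambda>x. L' #> x) ` generate (Y\<lparr>carrier := L\<rparr>) (\<delta> ` carrier G)"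
    using \<delta>_in_L by (intro \<pi>.generate_img) auto
  also have "generate (Y\<lparr>carrier := L\<rparr>) (\<delta> ` carrier G) = L"
    using Y.generate_consistent[OF _ subgroup_L, of "\<delta> ` carrier G"] \<delta>_in_L generate_\<delta> by auto
  finally show "generate L_ab ((\<lambda>g. L' #> \<delta> g) ` carrier G) = carrier L_ab"
    by (simp add: carrier_L_ab image_image)
qed

end

section \<open>Free products and the weak commutativity group\<close>

locale free_product_groups = G: group G + H: group H
  for G :: "('a, 'm) monoid_scheme" and H :: "('b, 'n) monoid_scheme"
begin

abbreviation F :: "('a + 'b) list set monoid" where
  "F \<equiv> free_product G H"

lemma fp_eq_words: "fp_eq G H u v \<Longrightarrow> u \<in> fp_words G H \<and> v \<in> fp_words G H"
  by (induction rule: fp_eq.induct) (auto simp: fp_words_def)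

definition cls :: "('a + 'b) list \<Rightarrow> ('a + 'b) list set" where
  "cls w = fp_rel G H `` {w}"

lemma equiv_fp_rel: "equiv (fp_words G H) (fp_rel G H)"
proof (rule equivI)
  show "fp_rel G H \<subseteq> fp_words G H \<times> fp_words G H"
    using fp_eq_words by (auto simp: fp_rel_def)
  show "refl_on (fp_words G H) (fp_rel G H)"
    by (auto simp: refl_on_def fp_rel_def intro: fp_eq.refl)
  show "sym_on UNIV (fp_rel G H)"
    unfolding fp_rel_def by (auto intro: symI fp_eq.sym)
  show "trans_on UNIV (fp_rel G H)"
    unfolding fp_rel_def by (auto intro: transI fp_eq.trans)
qed

lemma cls_eqI: "fp_eq G H u v \<Longrightarrow> cls u = cls v"
  using equiv_class_eq[OF equiv_fp_rel] by (auto simp: cls_def fp_rel_def)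

lemma in_cls_iff: "v \<in> cls u \<longleftrightarrow> fp_eq G H u v"
  by (simp add: cls_def fp_rel_def)

lemma cls_self: "w \<in> fp_words G H \<Longrightarrow> w \<in> cls w"
  by (simp add: in_cls_iff fp_eq.refl)

lemma carrier_F: "carrier F = cls ` fp_words G H"
  by (auto simp: free_product_def quotient_def cls_def)

lemma cls_closed [simp]: "w \<in> fp_words G H \<Longrightarrow> cls w \<in> carrier F"
  by (simp add: carrier_F)

lemma carrier_F_cases:
  assumes "a \<in> carrier F"
  obtains w where "w \<in> fp_words G H" "a = cls w"
  using assms unfolding carrier_F by blast

lemma one_F: "\<one>\<^bsub>F\<^esub> = cls []"
  by (simp add: free_product_def cls_def)

text \<open>Since \<open>fp_eq\<close> is a congruence for concatenation, the union defining the
  product does not depend on the representatives.\<close>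

lemma mult_cls:
  assumes "u \<in> fp_words G H" "v \<in> fp_words G H"
  shows "cls u \<otimes>\<^bsub>F\<^esub> cls v = cls (u @ v)"
proof -
  have "cls u \<otimes>\<^bsub>F\<^esub> cls v = (\<Union>u'\<in>cls u. \<Union>v'\<in>cls v. cls (u' @ v'))"
    by (simp add: free_product_def cls_def)
  also have "\<dots> = (\<Union>u'\<in>cls u. \<Union>v'\<in>cls v. cls (u @ v))"
    by (intro SUP_cong refl cls_eqI[symmetric] fp_eq.append)
      (use assms in \<open>auto simp: in_cls_iff fp_eq.refl\<close>)
  \<comment> \<open>The constant union collapses because both index classes are nonempty.\<close>
  also have "\<dots> = cls (u @ v)"
    using assms[THEN cls_self] by auto
  finally show ?thesis .
qed

lemma words_append [simp]: "u @ v \<in> fp_words G H \<longleftrightarrow> u \<in> fp_words G H \<and> v \<in> fp_words G H"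
  by (auto simp: fp_words_def)

lemma words_Nil [simp]: "[] \<in> fp_words G H"
  by (simp add: fp_words_def)

lemma words_Cons [simp]:
  "Inl x # w \<in> fp_words G H \<longleftrightarrow> x \<in> carrier G \<and> w \<in> fp_words G H"
  "Inr y # w \<in> fp_words G H \<longleftrightarrow> y \<in> carrier H \<and> w \<in> fp_words G H"
  by (auto simp: fp_words_def)

lemma letter_left_inverse:
  assumes "[c] \<in> fp_words G H"
  obtains c' where "[c'] \<in> fp_words G H" "cls [c', c] = cls []"
proof (cases c)
  case (Inl x)
  then have "fp_eq G H [Inl (inv\<^bsub>G\<^esub> x), Inl x] []"
    using assms fp_eq.mult_left[of "inv\<^bsub>G\<^esub> x" G x H] fp_eq.one_left[of G H] by (auto intro: fp_eq.trans)
  then show thesis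
    using assms Inl by (intro that[of "Inl (inv\<^bsub>G\<^esub> x)"]) (simp_all add: cls_eqI)
next
  case (Inr y)
  then have "fp_eq G H [Inr (inv\<^bsub>H\<^esub> y), Inr y] []"
    using assms fp_eq.mult_right[of "inv\<^bsub>H\<^esub> y" H y G] fp_eq.one_right[of G H] by (auto intro: fp_eq.trans)
  then show thesis
    using assms Inr by (intro that[of "Inr (inv\<^bsub>H\<^esub> y)"]) (simp_all add: cls_eqI)
qed

text \<open>The inverse word lists inverse letters in reverse order; a left inverse is all that
  \<open>groupI\<close> asks for.\<close>

lemma left_inverse: "w \<in> fp_words G H \<Longrightarrow> \<exists>v\<in>fp_words G H. cls (v @ w) = cls []"
proof (induction w)
  case (Cons c w)
  then have c: "[c] \<in> fp_words G H" and w: "w \<in> fp_words G H"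
    using words_append[of "[c]" w] by auto
  obtain c' where c': "[c'] \<in> fp_words G H" "cls [c', c] = cls []"
    using letter_left_inverse[OF c] .
  obtain v where v: "v \<in> fp_words G H" "cls (v @ w) = cls []"
    using Cons w by auto
  have cc: "[c', c] \<in> fp_words G H"
    using c c' words_append[of "[c']" "[c]"] by simp
  have "cls ((v @ [c']) @ c # w) = cls v \<otimes>\<^bsub>F\<^esub> (cls [c', c] \<otimes>\<^bsub>F\<^esub> cls w)"
    using v w cc words_append[of "[c',c]" w] by (simp add: mult_cls del: words_append)
  also have "\<dots> = cls []"
    using v w c' by (simp add: mult_cls)
  finally show ?case
    using v c' by (intro bexI[of _ "v @ [c']"]) auto
qed auto

lemma group_F: "group F"
proof (rule groupI)
  fix a b c assume a: "a \<in> carrier F" and b: "b \<in> carrier F"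
  obtain u v where u: "u \<in> fp_words G H" "a = cls u" and v: "v \<in> fp_words G H" "b = cls v"
    using a b by (blast elim: carrier_F_cases)
  then show "a \<otimes>\<^bsub>F\<^esub> b \<in> carrier F"
    by (simp add: mult_cls)
  assume "c \<in> carrier F"
  then obtain w where "w \<in> fp_words G H" "c = cls w"
    by (blast elim: carrier_F_cases)
  with u v show "a \<otimes>\<^bsub>F\<^esub> b \<otimes>\<^bsub>F\<^esub> c = a \<otimes>\<^bsub>F\<^esub> (b \<otimes>\<^bsub>F\<^esub> c)"
    by (simp add: mult_cls)
next
  fix a assume "a \<in> carrier F"
  then obtain w where w: "w \<in> fp_words G H" "a = cls w"
    by (blast elim: carrier_F_cases)
  then show "\<one>\<^bsub>F\<^esub> \<otimes>\<^bsub>F\<^esub> a = a"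
    by (simp add: one_F mult_cls)
  obtain v where "v \<in> fp_words G H" "cls (v @ w) = cls []"
    using w left_inverse by blast
  with w show "\<exists>b\<in>carrier F. b \<otimes>\<^bsub>F\<^esub> a = \<one>\<^bsub>F\<^esub>"
    by (intro bexI[of _ "cls v"]) (simp_all add: mult_cls one_F)
qed (simp add: one_F)

lemma fp_inl_eq: "fp_inl G H x = cls [Inl x]"
  by (simp add: fp_inl_def cls_def)

lemma fp_inr_eq: "fp_inr G H y = cls [Inr y]"
  by (simp add: fp_inr_def cls_def)

lemma fp_inl_hom: "fp_inl G H \<in> hom G F"
proof (rule homI)
  fix x y assume "x \<in> carrier G" "y \<in> carrier G"
  then show "fp_inl G H (x \<otimes>\<^bsub>G\<^esub> y) = fp_inl G H x \<otimes>\<^bsub>F\<^esub> fp_inl G H y"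
    by (simp add: fp_inl_eq mult_cls cls_eqI[OF fp_eq.mult_left])
qed (simp add: fp_inl_eq)

lemma fp_inr_hom: "fp_inr G H \<in> hom H F"
proof (rule homI)
  fix x y assume "x \<in> carrier H" "y \<in> carrier H"
  then show "fp_inr G H (x \<otimes>\<^bsub>H\<^esub> y) = fp_inr G H x \<otimes>\<^bsub>F\<^esub> fp_inr G H y"
    by (simp add: fp_inr_eq mult_cls cls_eqI[OF fp_eq.mult_right])
qed (simp add: fp_inr_eq)

lemma generate_F: "generate F (fp_inl G H ` carrier G \<union> fp_inr G H ` carrier H) = carrier F"
  (is "generate F ?U = _")
proof
  show "generate F ?U \<subseteq> carrier F"
    using hom_in_carrier[OF fp_inl_hom] hom_in_carrier[OF fp_inr_hom]
    by (intro group.generate_incl[OF group_F]) auto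
  have "cls w \<in> generate F ?U" if "w \<in> fp_words G H" for w
    using that
  proof (induction w)
    case Nil
    then show ?case by (simp add: one_F[symmetric] generate.one)
  next
    case (Cons c w)
    then have c: "[c] \<in> fp_words G H" and w: "w \<in> fp_words G H"
      using words_append[of "[c]" w] by auto
    have "cls [c] \<in> ?U"
      using c by (cases c) (auto simp: fp_inl_eq fp_inr_eq)
    then have "cls [c] \<otimes>\<^bsub>F\<^esub> cls w \<in> generate F ?U"
      by (rule generate.eng[OF generate.incl Cons.IH[OF w]])
    then show ?case
      using c w by (simp add: mult_cls)
  qed
  then show "carrier F \<subseteq> generate F ?U"
    by (auto simp: carrier_F)
qed

section \<open>Homomorphisms induced on the free product\<close>

context
  fixes K :: "('c, 'k) monoid_scheme" and f :: "'a \<Rightarrow> 'c" and h :: "'b \<Rightarrow> 'c"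
  assumes K: "group K" and f: "f \<in> hom G K" and h: "h \<in> hom H K"
begin

interpretation K: group K by (rule K)
interpretation f: group_hom G K f using f by unfold_locales
interpretation h: group_hom H K h using h by unfold_locales

definition word_eval :: "('a + 'b) list \<Rightarrow> 'c" where
  "word_eval w = foldr (\<lambda>s z. case_sum f h s \<otimes>\<^bsub>K\<^esub> z) w \<one>\<^bsub>K\<^esub>"

lemma word_eval_closed: "w \<in> fp_words G H \<Longrightarrow> word_eval w \<in> carrier K"
proof (induction w)
  case (Cons c w)
  then show ?case by (cases c) (simp_all add: word_eval_def)
qed (simp add: word_eval_def)

lemma word_eval_append:
  "\<lbrakk>u \<in> fp_words G H; v \<in> fp_words G H\<rbrakk> \<Longrightarrow> word_eval (u @ v) = word_eval u \<otimes>\<^bsub>K\<^esub> word_eval v"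
proof (induction u)
  case Nil
  then show ?case using word_eval_closed by (simp add: word_eval_def)
next
  case (Cons c u)
  then have u: "u \<in> fp_words G H" and c: "case_sum f h c \<in> carrier K"
    by (auto simp: fp_words_def split: sum.splits)
  have "word_eval (c # u @ v) = case_sum f h c \<otimes>\<^bsub>K\<^esub> word_eval (u @ v)"
    "word_eval (c # u) = case_sum f h c \<otimes>\<^bsub>K\<^esub> word_eval u"
    by (simp_all add: word_eval_def)
  then show ?case
    using Cons u c word_eval_closed by (simp add: K.m_assoc)
qed

text \<open>The defining relations hold in \<open>K\<close> because \<open>f\<close> and
  \<open>h\<close> are homomorphisms. So evaluation is constant on classes, and
  \<open>the_elem\<close> in \<open>fp_lift\<close> receives a singleton.\<close>

lemma word_eval_fp_eq: "fp_eq G H u v \<Longrightarrow> word_eval u = word_eval v"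
proof (induction rule: fp_eq.induct)
  case (append u u' v v')
  then show ?case
    using fp_eq_words by (metis word_eval_append)
qed (auto simp: word_eval_def)

lemma fp_lift_cls: "w \<in> fp_words G H \<Longrightarrow> fp_lift K f h (cls w) = word_eval w"
proof -
  assume w: "w \<in> fp_words G H"
  have "word_eval v = word_eval w" if "v \<in> cls w" for v
    using that word_eval_fp_eq[of w v] by (simp add: in_cls_iff)
  then have "word_eval ` cls w = {word_eval w}"
    using cls_self[OF w] by blast
  then show ?thesis
    by (simp add: fp_lift_def word_eval_def)
qed

lemma fp_lift_hom: "fp_lift K f h \<in> hom F K"
  by (rule homI; elim carrier_F_cases)
    (simp_all add: mult_cls fp_lift_cls word_eval_append word_eval_closed)

lemma fp_lift_inl: "x \<in> carrier G \<Longrightarrow> fp_lift K f h (fp_inl G H x) = f x"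
  using fp_lift_cls[of "[Inl x]"] by (simp add: fp_inl_eq word_eval_def)

lemma fp_lift_inr: "x \<in> carrier H \<Longrightarrow> fp_lift K f h (fp_inr G H x) = h x"
  using fp_lift_cls[of "[Inr x]"] by (simp add: fp_inr_eq word_eval_def)

end

end

section \<open>Normal closures and commutators\<close>

lemma (in group) normal_normal_closure:
  assumes "S \<subseteq> carrier G"
  shows "normal_closure G S \<lhd> G"
proof -
  let ?\<N> = "{N. N \<lhd> G \<and> S \<subseteq> N}"
  \<comment> \<open>The family must be nonempty, since an empty intersection would be the whole
    type.\<close>
  have "carrier G \<in> ?\<N>"
    using assms normal_self by simp
  then have "subgroup (\<Inter>?\<N>) G"
    by (intro subgroups_Inter) (auto dest: normal_imp_subgroup)
  then show ?thesis
    unfolding normal_closure_def normal_inv_iff by (auto dest: normal.inv_op_closed2)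
qed

lemma normal_closure_incl: "S \<subseteq> normal_closure G S"
  by (auto simp: normal_closure_def)

lemma normal_closure_least: "\<lbrakk>N \<lhd> G; S \<subseteq> N\<rbrakk> \<Longrightarrow> normal_closure G S \<subseteq> N"
  by (auto simp: normal_closure_def)

lemma (in group) commute_if_comm_elt_eq_one:
  assumes "x \<in> carrier G" "y \<in> carrier G" "comm_elt G x y = \<one>"
  shows "x \<otimes> y = y \<otimes> x"
proof -
  have "comm_elt G x y = inv (y \<otimes> x) \<otimes> (x \<otimes> y)"
    using assms(1,2) by (simp add: comm_elt_def inv_mult_group m_assoc)
  then show ?thesis
    using assms inv_solve_left'[of \<one> "y \<otimes> x" "x \<otimes> y"] by (metis m_closed one_closed r_one)
qed

lemma (in group_hom) comm_elt_hom:
  "\<lbrakk>x \<in> carrier G; y \<in> carrier G\<rbrakk> \<Longrightarrow> h (comm_elt G x y) = comm_elt H (h x) (h y)"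
  by (simp add: comm_elt_def)

text \<open>In \<XX>(G) the sections are the unbarred and the barred copy; both quotient maps and
  the projection are obtained from the free product.\<close>

lemma commuting_sections_wc:
  fixes G :: "('a, 'm) monoid_scheme"
  assumes "group G"
  shows "commuting_sections (wc_group G) G (wc_section G)
    (\<lambda>g. wc_kernel G #>\<^bsub>free_product G G\<^esub> fp_inr G G g) (wc_proj G)"
proof -
  interpret G: group G by (rule assms)
  interpret FP: free_product_groups G G by unfold_locales
  let ?F = "free_product G G" and ?l = "fp_inl G G" and ?r = "fp_inr G G" and ?N = "wc_kernel G"
  let ?lift = "fp_lift G (\<lambda>x. x) (\<lambda>x. x)"
  interpret F: group ?F by (rule FP.group_F)
  interpret l: group_hom G ?F ?l by unfold_locales (rule FP.fp_inl_hom)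
  interpret r: group_hom G ?F ?r by unfold_locales (rule FP.fp_inr_hom)
  have id: "(\<lambda>x. x) \<in> hom G G"
    by (simp add: hom_def)
  interpret lift: group_hom ?F G ?lift
    by unfold_locales (rule FP.fp_lift_hom[OF assms id id])
  have lift_l: "?lift (?l g) = g" and lift_r: "?lift (?r g) = g" if "g \<in> carrier G" for g
    using that FP.fp_lift_inl[OF assms id id] FP.fp_lift_inr[OF assms id id] by auto
  have rel: "wc_relators G \<subseteq> carrier ?F"
    by (auto simp: wc_relators_def comm_elt_def)
  interpret N: normal ?N ?F
    unfolding wc_kernel_def by (rule F.normal_normal_closure[OF rel])
  \<comment> \<open>The lift sends \<open>g\<close> and its barred copy to the same element, so each
    relator maps to the commutator of \<open>g\<close> with itself.\<close>
  have "wc_relators G \<subseteq> kernel ?F G ?lift"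
    using rel by (auto simp: kernel_def wc_relators_def lift.comm_elt_hom lift_l lift_r)
      (simp add: comm_elt_def G.m_assoc)
  then have N_kernel: "?N \<subseteq> kernel ?F G ?lift"
    unfolding wc_kernel_def by (intro normal_closure_least lift.normal_kernel)
  let ?X = "wc_group G"
  interpret X: group ?X
    unfolding wc_group_def by (rule N.factorgroup_is_group)
  interpret \<pi>: group_hom ?F ?X "\<lambda>x. ?N #>\<^bsub>?F\<^esub> x"
    by unfold_locales (simp add: wc_group_def N.r_coset_hom_Mod)
  have carrier_X: "carrier ?X = (\<lambda>x. ?N #>\<^bsub>?F\<^esub> x) ` carrier ?F"
    by (simp add: wc_group_def carrier_FactGroup)
  \<comment> \<open>The lift is constant on cosets of \<open>?N\<close>, which lies in its kernel,
    so \<open>the_elem\<close> in \<open>wc_proj\<close> is applied to a singleton.\<close>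
  have proj: "wc_proj G (?N #>\<^bsub>?F\<^esub> x) = ?lift x" if x: "x \<in> carrier ?F" for x
  proof -
    have "?lift y = ?lift x" if "y \<in> ?N #>\<^bsub>?F\<^esub> x" for y
      using that x N_kernel by (auto simp: r_coset_def kernel_def)
    then have "?lift ` (?N #>\<^bsub>?F\<^esub> x) = {?lift x}"
      using F.rcos_self[OF x N.subgroup_axioms] by blast
    then show ?thesis
      by (simp add: wc_proj_def)
  qed
  show ?thesis
  proof (unfold_locales, unfold wc_section_def)
    show "(\<lambda>g. ?N #>\<^bsub>?F\<^esub> ?l g) \<in> hom G ?X" "(\<lambda>g. ?N #>\<^bsub>?F\<^esub> ?r g) \<in> hom G ?X"
      by (auto intro!: homI)
    show "wc_proj G \<in> hom ?X G"
    proof (rule homI)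
      fix a b assume "a \<in> carrier ?X" "b \<in> carrier ?X"
      then obtain x y where "x \<in> carrier ?F" "y \<in> carrier ?F"
        "a = ?N #>\<^bsub>?F\<^esub> x" "b = ?N #>\<^bsub>?F\<^esub> y"
        by (auto simp: carrier_X)
      then show "wc_proj G (a \<otimes>\<^bsub>?X\<^esub> b) = wc_proj G a \<otimes>\<^bsub>G\<^esub> wc_proj G b"
        by (simp add: proj \<pi>.hom_mult[symmetric] del: \<pi>.hom_mult)
    qed (auto simp: carrier_X proj)
    fix g assume g: "g \<in> carrier G"
    then show "wc_proj G (?N #>\<^bsub>?F\<^esub> ?l g) = g" "wc_proj G (?N #>\<^bsub>?F\<^esub> ?r g) = g"
      by (simp_all add: proj lift_l lift_r)
    have "comm_elt ?F (?l g) (?r g) \<in> ?N"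
      using g normal_closure_incl[of "wc_relators G" ?F] by (auto simp: wc_kernel_def wc_relators_def)
    then have "?N #>\<^bsub>?F\<^esub> comm_elt ?F (?l g) (?r g) = \<one>\<^bsub>?X\<^esub>"
      by (simp add: wc_group_def N.rcos_const)
    then show "(?N #>\<^bsub>?F\<^esub> ?l g) \<otimes>\<^bsub>?X\<^esub> (?N #>\<^bsub>?F\<^esub> ?r g) = (?N #>\<^bsub>?F\<^esub> ?r g) \<otimes>\<^bsub>?X\<^esub> (?N #>\<^bsub>?F\<^esub> ?l g)"
      using g by (intro X.commute_if_comm_elt_eq_one) (simp_all add: \<pi>.comm_elt_hom)
  next
    let ?U = "?l ` carrier G \<union> ?r ` carrier G"
    have "generate ?X ((\<lambda>x. ?N #>\<^bsub>?F\<^esub> x) ` ?U) = (\<lambda>x. ?N #>\<^bsub>?F\<^esub> x) ` generate ?F ?U"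
      by (intro \<pi>.generate_img) auto
    then show "generate ?X ((\<lambda>g. ?N #>\<^bsub>?F\<^esub> ?l g) ` carrier G \<union> (\<lambda>g. ?N #>\<^bsub>?F\<^esub> ?r g) ` carrier G)
        = carrier ?X"
      by (simp add: FP.generate_F carrier_X image_Un image_image)
  qed
qed

theorem proposition3p1:
  fixes G :: "('a, 'm) monoid_scheme"
  assumes "group G" and "finitely_generated G"
  shows "nilpotent_action G (wc_L_ab G) (wc_action G)"
proof -
  interpret commuting_sections "wc_group G" G "wc_section G"
    "\<lambda>g. wc_kernel G #>\<^bsub>free_product G G\<^esub> fp_inr G G g" "wc_proj G"
    by (rule commuting_sections_wc[OF assms(1)])
  have L_ab: "L_ab = wc_L_ab G"
    by (simp add: L_ab_def wc_L_ab_def L_def wc_L_def)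
  have action: "conj_action = wc_action G"
    by (intro ext) (simp add: conj_action_def wc_action_def L_ab)
  have "nilpotent_action G L_ab conj_action"
    \<comment> \<open>The remaining goal is extensionality, built into \<open>conj_action\<close> by
      its restricted abstraction.\<close>
    by (rule nilpotent_action[OF assms(2)]) (simp add: conj_action_def)
  then show ?thesis
    by (simp add: L_ab action)
qed

end
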